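(* Consider positions of Version B in which all piles have at most $3$ tokens, with $a_1$ piles of size $1$, $a_2$ piles of size $2$, and $a_3$ piles of size $3$. Such a nonempty position (i.e. $(a_1,a_2,a_3)\neq(0,0,0)$) is a $\mathcal{P}$-position if and only if one of the following holds: \begin{itemize} \item $a_1$ is even, $a_2\geq 1$, and $a_3=0$; \item $a_1$ is odd, $a_2$ is odd, and $a_3=1$; \item $a_1$ is even, $a_2$ is odd, and $a_3\geq 2$. \end{itemize} Here "even" includes $0$.
   Context: Version B is a two-player impartial game. A position consists of finitely many piles of tokens; empty piles are ignored. The players alternate turns; on a turn, a player either removes a single token from any one nonempty pile, or removes one token from each (nonempty) pile. The last player to move wins. A position is a $\mathcal{P}$-position if the player who is not about to move has a winning strategy, equivalently if none of its options (positions reachable in one move) is a $\mathcal{P}$-position; otherwise it is an $\mathcal{N}$-position. *)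

theory Defs
  imports Main "HOL-Library.Multiset"
begin

text \<open>A position is the multiset of its pile sizes. A pile of size 0 may remain in the multiset;
  it is ignored in the sense that no move alters it and that it never makes a move available.\<close>

type_synonym position = "nat multiset"

inductive move :: "position \<Rightarrow> position \<Rightarrow> bool" where
  single: "n \<in># p \<Longrightarrow> n > 0 \<Longrightarrow> move p (add_mset (n - 1) (p - {#n#}))"
  \<comment> \<open>Truncated subtraction leaves empty piles empty. There must be a nonempty pile,
      since a move has to remove a token.\<close>
| each: "\<exists>n \<in># p. n > 0 \<Longrightarrow> move p (image_mset (\<lambda>n. n - 1) p)"

definition options :: "position \<Rightarrow> position set" where
  "options p = {q. move p q}"

lemma sum_mset_image_pred: "(\<Sum>n\<in>#p. n - 1) \<le> \<Sum>\<^sub># (p :: nat multiset)"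
  by (induction p) auto

lemma move_decreases:
  assumes "move p q"
  shows "\<Sum>\<^sub># q < \<Sum>\<^sub># p"
  using assms
proof cases
  case (single n)
  then obtain r where "p = add_mset n r"
    by (meson mset_add)
  with single show ?thesis by simp
next
  case each
  then obtain n r where "p = add_mset n r" "n > 0"
    by (meson mset_add)
  with each sum_mset_image_pred[of r] show ?thesis by simp
qed

function P_position :: "position \<Rightarrow> bool" where
  "P_position p \<longleftrightarrow> (\<forall>q \<in> options p. \<not> P_position q)"
  by auto
termination
  by (relation "measure sum_mset") (auto simp: options_def move_decreases)

declare P_position.simps [simp del]

end

theory Submission imports Defs begin

text \<open>With piles of size at most 3, a move acts only on the triple of counts: three
  single-token moves, and the move on all piles, \<open>(a1, a2, a3)\<close> to
  \<open>(a2, a3, 0)\<close>. Every move lowers the token total, so the P-positions are the only set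
  whose members are exactly the positions with no option in the set. It thus suffices that the
  claimed triples together with \<open>(0, 0, 0)\<close> have this property
  (\<open>P_counts_kernel\<close>), and to transfer it along \<open>ex_option_iff\<close>.\<close>

lemma each_pile_le:
  assumes "\<forall>n \<in># p. n \<le> k" "move p q"
  shows "\<forall>n \<in># q. n \<le> k"
  using assms(2)
proof cases
  case (single n)
  then show ?thesis using assms(1) by (auto dest: in_diffD)
next
  case each
  then show ?thesis using assms(1) by auto
qed

lemma count_image_pred:
  assumes "m > 0"
  shows "count (image_mset (\<lambda>n. n - 1) p) m = count p (Suc m)"
  using assms by (induction p) auto

text \<open>Reduces play on multisets to play on triples. \<open>R\<close> stays arbitrary here; it
  becomes \<open>P_counts\<close> later.\<close>

lemma ex_option_iff:
  assumes "\<forall>n \<in># p. n \<le> 3"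
  defines "a1 \<equiv> count p 1" and "a2 \<equiv> count p 2" and "a3 \<equiv> count p 3"
  shows "(\<exists>q \<in> options p. R (count q 1) (count q 2) (count q 3)) \<longleftrightarrow>
      (a1 > 0 \<and> R (a1 - 1) a2 a3)
    \<or> (a2 > 0 \<and> R (a1 + 1) (a2 - 1) a3)
    \<or> (a3 > 0 \<and> R a1 (a2 + 1) (a3 - 1))
    \<or> (a1 + a2 + a3 > 0 \<and> R a2 a3 0)"
    (is "?L \<longleftrightarrow> ?R")
proof -
  have cases3: "n = 1 \<or> n = 2 \<or> n = 3" if "n \<in># p" "n > 0" for n
    using assms(1) that by force
  \<comment> \<open>Piles of size 4 would become piles of size 3 under the move on all
    piles.\<close>
  have "count p 4 = 0"
    using assms(1) by (force simp: count_eq_zero_iff)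
  then have counts_each: "count (image_mset (\<lambda>n. n - 1) p) 1 = a2"
    "count (image_mset (\<lambda>n. n - 1) p) 2 = a3" "count (image_mset (\<lambda>n. n - 1) p) 3 = 0"
    by (simp_all add: count_image_pred a2_def a3_def del: One_nat_def)
  have nonempty_iff: "(\<exists>n \<in># p. n > 0) \<longleftrightarrow> a1 + a2 + a3 > 0"
    unfolding a1_def a2_def a3_def add_gr_0 count_greater_zero_iff using cases3
    by (metis zero_less_numeral zero_less_one)
  define S where "S n \<longleftrightarrow> (let q = add_mset (n - 1) (p - {#n#}) in
    R (count q 1) (count q 2) (count q 3))" for n
  have "?L \<longleftrightarrow> (\<exists>q. move p q \<and> R (count q 1) (count q 2) (count q 3))"
    by (simp add: options_def)
  also have "\<dots> \<longleftrightarrow> (\<exists>n. n \<in># p \<and> n > 0 \<and> S n) \<or> ((\<exists>n \<in># p. n > 0) \<and> R a2 a3 0)"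
    unfolding move.simps S_def Let_def counts_each[symmetric] by blast
  also have "(\<exists>n. n \<in># p \<and> n > 0 \<and> S n) \<longleftrightarrow>
      (a1 > 0 \<and> S 1) \<or> (a2 > 0 \<and> S 2) \<or> (a3 > 0 \<and> S 3)"
    unfolding a1_def a2_def a3_def count_greater_zero_iff using cases3
    by (metis zero_less_numeral zero_less_one)
  also have "S 1 \<longleftrightarrow> R (a1 - 1) a2 a3"
    by (simp add: S_def a1_def a2_def a3_def)
  also have "S 2 \<longleftrightarrow> R (a1 + 1) (a2 - 1) a3"
    by (simp add: S_def a1_def a2_def a3_def)
  also have "S 3 \<longleftrightarrow> R a1 (a2 + 1) (a3 - 1)"
    by (simp add: S_def a1_def a2_def a3_def)
  finally show ?thesis
    unfolding nonempty_iff by (simp only: disj_assoc)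
qed

text \<open>The zero triple is included because a position without tokens has no moves and is a
  P-position.\<close>

definition P_counts :: "nat \<Rightarrow> nat \<Rightarrow> nat \<Rightarrow> bool" where
  "P_counts a1 a2 a3 \<longleftrightarrow> (a1, a2, a3) = (0, 0, 0)
    \<or> (even a1 \<and> a2 \<ge> 1 \<and> a3 = 0)
    \<or> (odd a1 \<and> odd a2 \<and> a3 = 1)
    \<or> (even a1 \<and> odd a2 \<and> a3 \<ge> 2)"

text \<open>If \<open>a3 > 0\<close>, the move on all piles reaches the set iff \<open>a2\<close> is
  even. For odd \<open>a2\<close>, moves on a 2 or a 3 make \<open>a2\<close> even and so miss the
  set, except that a 3 may be the last one; moves on a 1 flip the parity of \<open>a1\<close>. If
  \<open>a3 = 0 < a2\<close>, single moves flip that parity; if only 1s remain, the move on all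
  piles ends the game.\<close>

lemma P_counts_kernel:
  "P_counts a1 a2 a3 \<longleftrightarrow> \<not> (
      (a1 > 0 \<and> P_counts (a1 - 1) a2 a3)
    \<or> (a2 > 0 \<and> P_counts (a1 + 1) (a2 - 1) a3)
    \<or> (a3 > 0 \<and> P_counts a1 (a2 + 1) (a3 - 1))
    \<or> (a1 + a2 + a3 > 0 \<and> P_counts a2 a3 0))"
proof -
  \<comment> \<open>From 3 on, both \<open>a3\<close> and \<open>a3 - 1\<close> lie in the range
    \<open>a3 \<ge> 2\<close>.\<close>
  consider "a3 = 0" | "a3 = 1" | "a3 = 2" | k where "a3 = Suc (Suc (Suc k))"
    by (metis One_nat_def Suc_1 not0_implies_Suc)
  then show ?thesis
    by cases (cases a1; cases a2; auto simp: P_counts_def)+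
qed

text \<open>Induction along the recursion of \<open>P_position\<close>; \<open>each_pile_le\<close>
  makes the hypothesis available for every option.\<close>

lemma P_position_iff_P_counts:
  assumes "\<forall>n \<in># p. n \<le> 3"
  shows "P_position p \<longleftrightarrow> P_counts (count p 1) (count p 2) (count p 3)"
  using assms
proof (induction p rule: P_position.induct)
  case (1 p)
  have "P_position p \<longleftrightarrow>
      \<not> (\<exists>q \<in> options p. P_counts (count q 1) (count q 2) (count q 3))"
    using 1 each_pile_le[of p 3] by (subst P_position.simps) (auto simp: options_def)
  also have "\<dots> \<longleftrightarrow> P_counts (count p 1) (count p 2) (count p 3)"
    unfolding ex_option_iff[OF "1.prems"] by (rule P_counts_kernel[symmetric])
  finally show ?case .
qed

theorem lemma2p7:
  fixes p :: position and a1 a2 a3 :: nat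
  assumes "\<forall>n \<in># p. n \<le> 3"
    and "a1 = count p 1" and "a2 = count p 2" and "a3 = count p 3"
    and "(a1, a2, a3) \<noteq> (0, 0, 0)"
  shows "P_position p \<longleftrightarrow>
      (even a1 \<and> a2 \<ge> 1 \<and> a3 = 0)
    \<or> (odd a1 \<and> odd a2 \<and> a3 = 1)
    \<or> (even a1 \<and> odd a2 \<and> a3 \<ge> 2)"
  using P_position_iff_P_counts[OF assms(1)] assms(2-5)
  unfolding P_counts_def by metis

end
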